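(* In general, even for a system of facet-defining inequalities describing a full-dimensional 0/1-polytope, sequential fixing is weaker than simultaneous fixing. That is, there exist a positive integer $d$, a full-dimensional 0/1-polytope $P\subseteq[0,1]^d$, a system $Ax\le b$ of linear inequalities, each of which is facet-defining for $P$, with $P=\{x\in\mathbb{R}^d: Ax\le b\}$, and a face $F$ of the cube $[0,1]^d$, such that $$\mathrm{Fix}_F(P)\subsetneq\mathrm{Fix}_F(Ax\le b).$$
   Context: A 0/1-polytope is the convex hull of a set of 0/1-vectors. For disjoint $I_0,I_1\subseteq\{1,\dots,d\}$, the face of the cube $[0,1]^d$ defined by $(I_0,I_1)$ is $\{x\in[0,1]^d: x_i=0\ (i\in I_0),\ x_i=1\ (i\in I_1)\}$; all nonempty faces of the cube are of this type. Simultaneous fixing: for a polytope $P\subseteq[0,1]^d$ and a face $F$ of $[0,1]^d$, $\mathrm{Fix}_F(P)$ is the smallest face of $[0,1]^d$ that contains $P\cap F\cap\{0,1\}^d$ (the empty face if this set is empty). Sequential fixing: let $P=\{x\in[0,1]^d: Ax\le b\}$, where $Ax\le b$ has rows $a_r^Tx\le b_r$, $r=1,\dots,m$, and let $P_r=\{x\in[0,1]^d: a_r^Tx\le b_r\}$. Then $\mathrm{Fix}_F(Ax\le b)$ is the face $G$ of $[0,1]^d$ obtained by starting with $G:=F$ and iteratively replacing $G$ by $\mathrm{Fix}_G(P_r)$ as long as there is some $r\in\{1,\dots,m\}$ with $\mathrm{Fix}_G(P_r)\subsetneq G$. (The result does not depend on the choices of $r$, and $\mathrm{Fix}_F(P)\subseteq\mathrm{Fix}_F(Ax\le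 b)$ always holds.) *)

theory Defs
  imports "HOL-Analysis.Analysis" "HOL-Analysis.Finite_Function_Topology"
begin

text \<open>Since the dimension is quantified inside the statement, \<open>\<real>\<^sup>d\<close> is the space of the
  finitely supported functions on \<open>nat\<close> that vanish outside \<open>{..<d}\<close>; coordinates are numbered
  from \<open>0\<close>. The ambient type is a \<open>real_vector\<close>, so \<open>convex hull\<close>, \<open>affine hull\<close> and
  \<open>face_of\<close> are those of the library.\<close>

type_synonym rvec = "nat \<Rightarrow>\<^sub>0 real"

abbreviation coord :: "rvec \<Rightarrow> nat \<Rightarrow> real" where
  "coord \<equiv> Poly_Mapping.lookup"

definition space_R :: "nat \<Rightarrow> rvec set" where
  "space_R d = {x. \<forall>i\<ge>d. coord x i = 0}"

definition cube :: "nat \<Rightarrow> rvec set" where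
  "cube d = {x \<in> space_R d. \<forall>i<d. 0 \<le> coord x i \<and> coord x i \<le> 1}"

definition zero_one_vectors :: "nat \<Rightarrow> rvec set" where
  "zero_one_vectors d = {x \<in> space_R d. \<forall>i<d. coord x i = 0 \<or> coord x i = 1}"

definition zero_one_polytope :: "nat \<Rightarrow> rvec set \<Rightarrow> bool" where
  "zero_one_polytope d P \<longleftrightarrow> (\<exists>V \<subseteq> zero_one_vectors d. P = convex hull V)"

text \<open>The library restricts \<open>aff_dim\<close> and \<open>facet_of\<close> to \<open>euclidean_space\<close>; the following two
  definitions repeat their defining formulas over \<open>real_vector\<close>.\<close>

definition affdim :: "'a::real_vector set \<Rightarrow> int" where
  "affdim S = (SOME d :: int. \<exists>B. affine hull B = affine hull S \<and> \<not> affine_dependent B \<and>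
                                  of_nat (card B) = d + 1)"

definition is_facet :: "'a::real_vector set \<Rightarrow> 'a set \<Rightarrow> bool" where
  "is_facet T S \<longleftrightarrow> T face_of S \<and> T \<noteq> {} \<and> affdim T = affdim S - 1"

lemma affdim_eq_aff_dim: "affdim S = aff_dim S"
  unfolding affdim_def aff_dim_def ..

text \<open>The choice in \<open>affdim\<close> is unique over every \<open>real_vector\<close> as soon as a finite affine
  basis exists.\<close>

lemma affine_basis_span:
  fixes B :: "'a::real_vector set"
  assumes "\<not> affine_dependent B" "a \<in> B"
  defines "D \<equiv> (\<lambda>x. - a + x) ` (B - {a})"
  shows "independent D"
    and "span D = {x - y | x y. x \<in> affine hull B \<and> y \<in> affine hull B}"
    and "bij_betw (\<lambda>x. - a + x) (B - {a}) D"
proof -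
  show "independent D"
    using affine_dependent_iff_dependent[of a "B - {a}"] assms
    by (simp add: insert_absorb)
  have hull: "affine hull B = (\<lambda>x. a + x) ` span D"
    unfolding D_def by (rule affine_hull_span2) (rule assms(2))
  show "span D = {x - y | x y. x \<in> affine hull B \<and> y \<in> affine hull B}"
  proof (intro equalityI subsetI)
    fix v assume "v \<in> span D"
    then have "a + v \<in> affine hull B" "a + 0 \<in> affine hull B"
      unfolding hull using span_zero by blast+
    then show "v \<in> {x - y | x y. x \<in> affine hull B \<and> y \<in> affine hull B}"
      by (intro CollectI exI[of _ "a + v"] exI[of _ "a + 0"]) auto
  next
    fix v assume "v \<in> {x - y | x y. x \<in> affine hull B \<and> y \<in> affine hull B}"
    then show "v \<in> span D" unfolding hull using span_diff by fastforce
  qed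
  show "bij_betw (\<lambda>x. - a + x) (B - {a}) D"
    unfolding D_def by (auto simp: bij_betw_def inj_on_def)
qed

lemma affdim_eqI:
  fixes B :: "'a::real_vector set"
  assumes "affine hull B = affine hull S" "\<not> affine_dependent B" "finite B"
  shows "affdim S = int (card B) - 1"
proof -
  have card: "card C = card B" if C: "affine hull C = affine hull B" "\<not> affine_dependent C" for C
  proof (cases "B = {}")
    case True then show ?thesis using C(1) by simp
  next
    case False
    with C(1) have "C \<noteq> {}" by auto
    with False obtain a c where a: "a \<in> B" and c: "c \<in> C" by blast
    note B' = affine_basis_span[OF assms(2) a] and C' = affine_basis_span[OF C(2) c]
    have eq: "span ((\<lambda>x. - a + x) ` (B - {a})) = span ((\<lambda>x. - c + x) ` (C - {c}))"
      unfolding B'(2) C'(2) C(1) ..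
    obtain f where "bij_betw f ((\<lambda>x. - a + x) ` (B - {a})) ((\<lambda>x. - c + x) ` (C - {c}))"
      using bij_if_span_eq_span_bases[OF B'(1) C'(1) eq] by blast
    then have "bij_betw f ((\<lambda>x. - a + x) ` (B - {a})) ((\<lambda>x. - c + x) ` (C - {c}))" .
    from bij_betw_trans[OF B'(3) this] have "finite (C - {c}) = finite (B - {a})"
      "card (C - {c}) = card (B - {a})"
      using C'(3) bij_betw_finite bij_betw_same_card by metis+
    then show ?thesis using a c assms(3)
      by (metis card_Suc_Diff1 finite_Diff finite_insert insert_Diff)
  qed
  show ?thesis
    unfolding affdim_def
  proof (rule some_equality)
    show "\<exists>B'. affine hull B' = affine hull S \<and> \<not> affine_dependent B' \<and>
               of_nat (card B') = int (card B) - 1 + 1"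
      using assms by (intro exI[of _ B]) simp
  next
    fix d :: int assume "\<exists>C. affine hull C = affine hull S \<and> \<not> affine_dependent C \<and>
                      of_nat (card C) = d + 1"
    then show "d = int (card B) - 1" using card assms(1) by force
  qed
qed

lemma is_facet_eq_facet_of: "is_facet T S \<longleftrightarrow> T facet_of S"
  unfolding is_facet_def facet_of_def affdim_eq_aff_dim ..

definition lin :: "nat \<Rightarrow> (nat \<Rightarrow> real) \<Rightarrow> rvec \<Rightarrow> real" where
  "lin d a x = (\<Sum>j<d. a j * coord x j)"

definition facet_defining :: "nat \<Rightarrow> rvec set \<Rightarrow> (nat \<Rightarrow> real) \<Rightarrow> real \<Rightarrow> bool" where
  "facet_defining d P a \<beta> \<longleftrightarrow>
     (\<forall>x\<in>P. lin d a x \<le> \<beta>) \<and> is_facet {x \<in> P. lin d a x = \<beta>} P"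

definition polyhedron_of :: "nat \<Rightarrow> nat \<Rightarrow> (nat \<Rightarrow> nat \<Rightarrow> real) \<Rightarrow> (nat \<Rightarrow> real) \<Rightarrow> rvec set" where
  "polyhedron_of d m A b = {x \<in> space_R d. \<forall>r<m. lin d (A r) x \<le> b r}"

definition row_polytope :: "nat \<Rightarrow> (nat \<Rightarrow> real) \<Rightarrow> real \<Rightarrow> rvec set" where
  "row_polytope d a \<beta> = {x \<in> cube d. lin d a x \<le> \<beta>}"

definition sim_fix :: "nat \<Rightarrow> rvec set \<Rightarrow> rvec set \<Rightarrow> rvec set" where
  "sim_fix d P F = (LEAST G. G face_of cube d \<and> P \<inter> F \<inter> zero_one_vectors d \<subseteq> G)"

definition fix_step ::
  "nat \<Rightarrow> nat \<Rightarrow> (nat \<Rightarrow> nat \<Rightarrow> real) \<Rightarrow> (nat \<Rightarrow> real) \<Rightarrow> rvec set \<Rightarrow> rvec set \<Rightarrow> bool" where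
  "fix_step d m A b G G' \<longleftrightarrow>
     (\<exists>r<m. G' = sim_fix d (row_polytope d (A r) (b r)) G \<and> G' \<subset> G)"

text \<open>The final face of any maximal sequence of steps; unique by \<open>seq_fix_ex1\<close> below.\<close>

definition seq_fix ::
  "nat \<Rightarrow> nat \<Rightarrow> (nat \<Rightarrow> nat \<Rightarrow> real) \<Rightarrow> (nat \<Rightarrow> real) \<Rightarrow> rvec set \<Rightarrow> rvec set" where
  "seq_fix d m A b F =
     (THE G. (fix_step d m A b)\<^sup>*\<^sup>* F G \<and> (\<nexists>H. fix_step d m A b G H))"

subsection \<open>The faces of the cube\<close>

lemma coord_scaleR [simp]: "coord (c *\<^sub>R x) i = c * coord x i"
proof -
  have "finite {i. c *\<^sub>R coord x i \<noteq> 0}"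
    by (rule finite_subset[OF _ finite_keys[of x]]) (auto simp: in_keys_iff)
  then show ?thesis
    unfolding scaleR_poly_mapping_def by (simp add: Abs_poly_mapping_inverse)
qed

lemma convex_cube: "convex (cube d)"
proof (rule convexI)
  fix x y and u v :: real
  assume "x \<in> cube d" "y \<in> cube d" and uv: "0 \<le> u" "0 \<le> v" "u + v = 1"
  moreover have "u * p + v * q \<le> 1" if "p \<le> 1" "q \<le> 1" for p q :: real
    using convex_bound_le[of p 1 q u v] that uv by simp
  ultimately show "u *\<^sub>R x + v *\<^sub>R y \<in> cube d"
    by (auto simp: cube_def space_R_def lookup_add)
qed

lemma cube_bounds: "x \<in> cube d \<Longrightarrow> 0 \<le> coord x i \<and> coord x i \<le> 1"
  by (cases "i < d") (auto simp: cube_def space_R_def)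

lemma convex_comb_extreme:
  fixes a b u :: real
  assumes "0 < u" "u < 1" "0 \<le> a" "0 \<le> b" "(1 - u) * a + u * b = 0"
  shows "a = 0 \<and> b = 0"
  using assms by (smt (verit) mult_nonneg_nonneg mult_pos_pos)

lemma coordinate_face:
  "{x \<in> cube d. (\<forall>i\<in>I0. coord x i = 0) \<and> (\<forall>i\<in>I1. coord x i = 1)} face_of cube d"
    (is "?F face_of _")
  unfolding face_of_def
proof (intro conjI ballI impI)
  show "?F \<subseteq> cube d" by blast
  show "convex ?F"
  proof (rule convexI)
    fix x y and u v :: real
    assume "x \<in> ?F" "y \<in> ?F" "0 \<le> u" "0 \<le> v" "u + v = 1"
    then show "u *\<^sub>R x + v *\<^sub>R y \<in> ?F"
      using convexD[OF convex_cube[of d], of x y u v] by (auto simp: lookup_add)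
  qed
next
  fix a b x assume a: "a \<in> cube d" and b: "b \<in> cube d" and x: "x \<in> ?F" "x \<in> open_segment a b"
  then obtain u where u: "0 < u" "u < 1" "x = (1 - u) *\<^sub>R a + u *\<^sub>R b"
    by (auto simp: in_segment)
  have 0: "coord a i = 0 \<and> coord b i = 0" if "i \<in> I0" for i
  proof (rule convex_comb_extreme[OF u(1,2)])
    show "(1 - u) * coord a i + u * coord b i = 0"
      using x(1) that u(3) by (simp add: lookup_add)
  qed (use a b cube_bounds in auto)
  have "1 - coord a i = 0 \<and> 1 - coord b i = 0" if "i \<in> I1" for i
  proof (rule convex_comb_extreme[OF u(1,2)])
    have "(1 - u) * coord a i + u * coord b i = 1"
      using x(1) that u(3) by (simp add: lookup_add)
    then show "(1 - u) * (1 - coord a i) + u * (1 - coord b i) = 0"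
      by (simp add: algebra_simps)
  qed (use a b cube_bounds in auto)
  with 0 a b show "a \<in> ?F" "b \<in> ?F" by auto
qed

lemma face_of_cube_iff:
  "F face_of cube d \<longleftrightarrow>
     F = {} \<or> (\<exists>I0 I1. I0 \<subseteq> {..<d} \<and> I1 \<subseteq> {..<d} \<and> I0 \<inter> I1 = {} \<and>
       F = {x \<in> cube d. (\<forall>i\<in>I0. coord x i = 0) \<and> (\<forall>i\<in>I1. coord x i = 1)})"
proof
  assume face: "F face_of cube d"
  then have sub: "F \<subseteq> cube d" and conv: "convex F" by (auto simp: face_of_def)
  show "F = {} \<or> (\<exists>I0 I1. I0 \<subseteq> {..<d} \<and> I1 \<subseteq> {..<d} \<and> I0 \<inter> I1 = {} \<and>
       F = {x \<in> cube d. (\<forall>i\<in>I0. coord x i = 0) \<and> (\<forall>i\<in>I1. coord x i = 1)})"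
  proof (cases "F = {}")
    case False
    then obtain x0 where x0: "x0 \<in> F" by blast
    define I0 where "I0 = {i. i < d \<and> (\<forall>x\<in>F. coord x i = 0)}"
    define I1 where "I1 = {i. i < d \<and> (\<forall>x\<in>F. coord x i = 1)}"
    define G where "G = {x \<in> cube d. (\<forall>i\<in>I0. coord x i = 0) \<and> (\<forall>i\<in>I1. coord x i = 1)}"
    have "\<exists>y\<in>F. \<forall>i<n. (i \<notin> I0 \<longrightarrow> 0 < coord y i) \<and> (i \<notin> I1 \<longrightarrow> coord y i < 1)" if "n \<le> d" for n
      using that
    proof (induction n)
      case 0 then show ?case using x0 by auto
    next
      case (Suc n)
      then obtain y where y: "y \<in> F"
        "\<And>i. i < n \<Longrightarrow> (i \<notin> I0 \<longrightarrow> 0 < coord y i) \<and> (i \<notin> I1 \<longrightarrow> coord y i < 1)" by auto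
      obtain p where p: "p \<in> F" "n \<notin> I0 \<Longrightarrow> 0 < coord p n"
      proof (cases "n \<in> I0")
        case False
        then obtain p where "p \<in> F" "coord p n \<noteq> 0" using Suc.prems by (auto simp: I0_def)
        moreover have "0 \<le> coord p n" using cube_bounds[of p d n] sub \<open>p \<in> F\<close> by auto
        ultimately show ?thesis using that by (simp add: less_le)
      qed (use x0 that in auto)
      obtain q where q: "q \<in> F" "n \<notin> I1 \<Longrightarrow> coord q n < 1"
      proof (cases "n \<in> I1")
        case False
        then obtain q where "q \<in> F" "coord q n \<noteq> 1" using Suc.prems by (auto simp: I1_def)
        moreover have "coord q n \<le> 1" using cube_bounds[of q d n] sub \<open>q \<in> F\<close> by auto
        ultimately show ?thesis using that by (simp add: less_le)
      qed (use x0 that in auto)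
      define z where "z = (1/2) *\<^sub>R y + (1/2) *\<^sub>R ((1/2) *\<^sub>R p + (1/2) *\<^sub>R q)"
      have "z \<in> F"
        unfolding z_def using y(1) p(1) q(1) by (intro convexD[OF conv]) auto
      moreover have "(i \<notin> I0 \<longrightarrow> 0 < coord z i) \<and> (i \<notin> I1 \<longrightarrow> coord z i < 1)" if "i < Suc n" for i
      proof -
        have "coord z i = coord y i / 2 + coord p i / 4 + coord q i / 4"
          by (simp add: z_def lookup_add field_simps)
        moreover have "0 \<le> coord y i \<and> coord y i \<le> 1" "0 \<le> coord p i \<and> coord p i \<le> 1"
          "0 \<le> coord q i \<and> coord q i \<le> 1"
          using cube_bounds sub y(1) p(1) q(1) by blast+
        moreover have "i < n \<or> i = n" using that by auto
        ultimately show ?thesis using y(2)[of i] p(2) q(2) by auto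
      qed
      ultimately show ?case by blast
    qed
    from this[of d] obtain y where y: "y \<in> F"
      "\<And>i. i < d \<Longrightarrow> (i \<notin> I0 \<longrightarrow> 0 < coord y i) \<and> (i \<notin> I1 \<longrightarrow> coord y i < 1)" by auto
    have yc: "y \<in> cube d" using y(1) sub by blast
    have "\<exists>e>0. \<forall>i<n. i \<notin> I0 \<union> I1 \<longrightarrow> e \<le> coord y i \<and> e \<le> 1 - coord y i" if "n \<le> d" for n
      using that
    proof (induction n)
      case 0 then show ?case by (intro exI[of _ 1]) auto
    next
      case (Suc n)
      then obtain e where e: "e > 0"
        "\<And>i. i < n \<Longrightarrow> i \<notin> I0 \<union> I1 \<Longrightarrow> e \<le> coord y i \<and> e \<le> 1 - coord y i" by auto
      show ?case
      proof (cases "n \<in> I0 \<union> I1")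
        case True then show ?thesis using e by (intro exI[of _ e]) (auto simp: less_Suc_eq)
      next
        case False
        then have "0 < coord y n" "coord y n < 1" using y(2)[of n] Suc.prems by auto
        then show ?thesis using e
          by (intro exI[of _ "min e (min (coord y n) (1 - coord y n))"])
            (auto simp: less_Suc_eq min_le_iff_disj)
      qed
    qed
    from this[of d] obtain e where e: "e > 0"
      "\<And>i. i < d \<Longrightarrow> i \<notin> I0 \<Longrightarrow> i \<notin> I1 \<Longrightarrow> e \<le> coord y i \<and> e \<le> 1 - coord y i" by auto
    have "G \<subseteq> F"
    proof
      fix z assume z: "z \<in> G"
      then have zc: "z \<in> cube d" by (simp add: G_def)
      show "z \<in> F"
      proof (cases "z = y")
        case False
        define w where "w = y + e *\<^sub>R (y - z)"
        have cw: "coord w i = coord y i + e * (coord y i - coord z i)" for i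
          by (simp add: w_def lookup_add lookup_minus)
        have "w \<in> cube d"
          unfolding cube_def space_R_def
        proof (intro CollectI conjI allI impI)
          fix i assume "d \<le> i"
          then show "coord w i = 0" using yc zc by (simp add: cw cube_def space_R_def)
        next
          fix i assume i: "i < d"
          have "0 \<le> coord w i \<and> coord w i \<le> 1"
          proof (cases "i \<in> I0 \<union> I1")
            case True
            then have "coord y i = coord z i" "coord y i = 0 \<or> coord y i = 1"
              using y(1) z by (auto simp: I0_def I1_def G_def)
            then show ?thesis by (auto simp: cw)
          next
            case False
            have "\<bar>coord y i - coord z i\<bar> \<le> 1"
              using cube_bounds[OF yc, of i] cube_bounds[OF zc, of i] by auto
            then have "\<bar>e * (coord y i - coord z i)\<bar> \<le> e"
              using e(1) by (simp add: abs_mult)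
            then show ?thesis using e(2)[OF i] False by (auto simp: cw abs_le_iff)
          qed
          then show "0 \<le> coord w i" "coord w i \<le> 1" by auto
        qed
        moreover have "y \<in> open_segment w z"
        proof -
          have y_eq: "y = (1 - e / (1 + e)) *\<^sub>R w + (e / (1 + e)) *\<^sub>R z"
          proof (rule poly_mapping_eqI)
            fix i
            show "coord y i = coord ((1 - e / (1 + e)) *\<^sub>R w + (e / (1 + e)) *\<^sub>R z) i"
            proof -
              define t where "t = 1 / (1 + e)"
              have t: "1 - e * t = t" "e / (1 + e) = e * t" "(1 + e) * t = 1"
                using e(1) by (auto simp: t_def field_simps)
              have "coord y i = ((1 + e) * t) * coord y i" unfolding t(3) by simp
              also have "\<dots> = t * (coord y i + e * (coord y i - coord z i)) + e * t * coord z i"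
                by (simp add: algebra_simps)
              finally show ?thesis
                unfolding t(2) by (simp only: lookup_add coord_scaleR cw t(1))
            qed
          qed
          have "w \<noteq> z"
          proof
            assume "w = z"
            then have "(1 + e) *\<^sub>R (y - z) = 0" by (simp add: w_def algebra_simps)
            then show False using False e(1) by auto
          qed
          moreover have "0 < e / (1 + e)" "e / (1 + e) < 1" using e(1) by auto
          ultimately show ?thesis unfolding in_segment using y_eq by blast
        qed
        ultimately show ?thesis using face zc y(1) unfolding face_of_def by blast
      qed (use y(1) in auto)
    qed
    moreover have "F \<subseteq> G" using sub by (auto simp: G_def I0_def I1_def)
    ultimately have "F = G" by blast
    moreover have "I0 \<inter> I1 = {}" using x0 by (auto simp: I0_def I1_def)
    moreover have "I0 \<subseteq> {..<d}" "I1 \<subseteq> {..<d}" by (auto simp: I0_def I1_def)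
    ultimately show ?thesis unfolding G_def by blast
  qed simp
qed (use coordinate_face in auto)

lemma finite_faces_cube: "finite {F. F face_of cube d}"
proof -
  define f where "f = (\<lambda>(I0, I1).
    {x \<in> cube d. (\<forall>i\<in>I0. coord x i = 0) \<and> (\<forall>i\<in>I1. coord x i = 1)})"
  have "{F. F face_of cube d} \<subseteq> insert {} (f ` (Pow {..<d} \<times> Pow {..<d}))"
    unfolding face_of_cube_iff by (force simp: f_def)
  then show ?thesis by (rule finite_subset) auto
qed

subsection \<open>Both kinds of fixing are well defined\<close>

lemma zero_one_vectors_subset_cube: "zero_one_vectors d \<subseteq> cube d"
  by (force simp: zero_one_vectors_def cube_def)

lemma sim_fix_eq_Inter:
  "sim_fix d P F = \<Inter>{G. G face_of cube d \<and> P \<inter> F \<inter> zero_one_vectors d \<subseteq> G}" (is "_ = \<Inter>?A")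
  and sim_fix_face: "sim_fix d P F face_of cube d"
  and sim_fix_contains: "P \<inter> F \<inter> zero_one_vectors d \<subseteq> sim_fix d P F"
  and sim_fix_least:
    "\<lbrakk>G face_of cube d; P \<inter> F \<inter> zero_one_vectors d \<subseteq> G\<rbrakk> \<Longrightarrow> sim_fix d P F \<subseteq> G"
proof -
  have "cube d \<in> ?A"
    using zero_one_vectors_subset_cube face_of_refl[OF convex_cube] by auto
  then have face: "\<Inter>?A face_of cube d" by (intro face_of_Inter) auto
  show *: "sim_fix d P F = \<Inter>?A"
    unfolding sim_fix_def by (rule Least_equality) (use face in auto)
  show "sim_fix d P F face_of cube d" using face * by simp
  show "P \<inter> F \<inter> zero_one_vectors d \<subseteq> sim_fix d P F" unfolding * by blast
  show "\<lbrakk>G face_of cube d; P \<inter> F \<inter> zero_one_vectors d \<subseteq> G\<rbrakk> \<Longrightarrow> sim_fix d P F \<subseteq> G"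
    unfolding * by blast
qed

lemma sim_fix_subset: "F face_of cube d \<Longrightarrow> sim_fix d P F \<subseteq> F"
  by (rule sim_fix_least) auto

lemma sim_fix_mono: "G \<subseteq> H \<Longrightarrow> sim_fix d P G \<subseteq> sim_fix d P H"
  by (rule sim_fix_least[OF sim_fix_face]) (use sim_fix_contains[of P H d] in blast)

lemma fix_steps_face:
  "\<lbrakk>(fix_step d m A b)\<^sup>*\<^sup>* F G; F face_of cube d\<rbrakk> \<Longrightarrow> G face_of cube d"
  by (induction rule: rtranclp_induct) (auto simp: fix_step_def sim_fix_face)

lemma fix_steps_subset: "(fix_step d m A b)\<^sup>*\<^sup>* F G \<Longrightarrow> G \<subseteq> F"
  by (induction rule: rtranclp_induct) (auto simp: fix_step_def)

lemma final_subset: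
  assumes "G face_of cube d" "\<nexists>H. fix_step d m A b G H" "G \<subseteq> F" "(fix_step d m A b)\<^sup>*\<^sup>* F H"
  shows "G \<subseteq> H"
  using assms(4)
proof (induction rule: rtranclp_induct)
  case (step H H')
  then obtain r where r: "r < m" "H' = sim_fix d (row_polytope d (A r) (b r)) H"
    by (auto simp: fix_step_def)
  have "sim_fix d (row_polytope d (A r) (b r)) G = G"
    using assms(2) r(1) sim_fix_subset[OF assms(1)] unfolding fix_step_def by blast
  then show ?case using sim_fix_mono[OF step.IH] r(2) by metis
qed (use assms(3) in simp)

lemma seq_fix_ex1:
  assumes "F face_of cube d"
  shows "\<exists>!G. (fix_step d m A b)\<^sup>*\<^sup>* F G \<and> (\<nexists>H. fix_step d m A b G H)"
proof (rule ex_ex1I)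
  let ?R = "{G. (fix_step d m A b)\<^sup>*\<^sup>* F G}"
  have "finite ?R"
    by (rule finite_subset[OF _ finite_faces_cube[of d]]) (use fix_steps_face assms in blast)
  moreover have "F \<in> ?R" by simp
  ultimately obtain G where G: "G \<in> ?R" "\<And>H. H \<in> ?R \<Longrightarrow> H \<subseteq> G \<Longrightarrow> H = G"
    using finite_has_minimal2[of ?R F] by blast
  have False if "fix_step d m A b G H" for H
    using G(2)[of H] G(1) that rtranclp.rtrancl_into_rtrancl[of _ F G H]
    by (auto simp: fix_step_def)
  then show "\<exists>G. (fix_step d m A b)\<^sup>*\<^sup>* F G \<and> (\<nexists>H. fix_step d m A b G H)" using G(1) by blast
next
  fix G G'
  assume G: "(fix_step d m A b)\<^sup>*\<^sup>* F G \<and> (\<nexists>H. fix_step d m A b G H)"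
    and G': "(fix_step d m A b)\<^sup>*\<^sup>* F G' \<and> (\<nexists>H. fix_step d m A b G' H)"
  show "G = G'"
    using final_subset[of G d m A b F G'] final_subset[of G' d m A b F G] G G'
      fix_steps_face[OF _ assms] fix_steps_subset by blast
qed

end

theory Submission
  imports Defs
begin

text \<open>The example is a simplex \<open>P\<close> in \<open>\<real>\<^sup>4\<close> with vertices \<open>0\<close>, \<open>(1,1,1,1)\<close> and \<open>(e\<^sub>i,1)\<close> for
  \<open>i = 1, 2, 3\<close>, so its facet inequalities say that the barycentric coordinates \<open>1 - w\<close>,
  \<open>(y\<^sub>1 + y\<^sub>2 + y\<^sub>3 - w)/2\<close> and \<open>(w + y\<^sub>i - y\<^sub>j - y\<^sub>k)/2\<close> of \<open>(y,w)\<close> are nonnegative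
  (with \<open>{i,j,k} = {1,2,3}\<close>). On the face \<open>w = 0\<close> of the cube the first two conditions hold
  throughout and the last three read \<open>y\<^sub>j + y\<^sub>k \<le> y\<^sub>i\<close>. Together they force \<open>y = 0\<close>, but each single
  one is satisfied by \<open>0\<close>, \<open>e\<^sub>i\<close>, \<open>e\<^sub>i + e\<^sub>j\<close> and \<open>e\<^sub>i + e\<^sub>k\<close>, so that it fixes no coordinate.\<close>

section \<open>Linear functionals and the faces they cut out\<close>

lemma lin_add: "lin d a (x + y) = lin d a x + lin d a y"
  by (simp add: lin_def lookup_add distrib_left sum.distrib)

lemma lin_scaleR: "lin d a (c *\<^sub>R x) = c * lin d a x"
  by (simp add: lin_def sum_distrib_left mult_ac)

lemma lin_sum: "finite I \<Longrightarrow> lin d a (\<Sum>i\<in>I. f i) = (\<Sum>i\<in>I. lin d a (f i))"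
  by (induction I rule: finite_induct) (simp_all add: lin_add, simp add: lin_def)

lemma convex_polyhedron_of: "convex (polyhedron_of d m A b)"
proof (rule convexI)
  fix x y and u v :: real
  assume *: "x \<in> polyhedron_of d m A b" "y \<in> polyhedron_of d m A b" "0 \<le> u" "0 \<le> v" "u + v = 1"
  have "u * lin d (A r) x + v * lin d (A r) y \<le> b r" if "r < m" for r
    using * that by (intro convex_bound_le) (auto simp: polyhedron_of_def)
  then show "u *\<^sub>R x + v *\<^sub>R y \<in> polyhedron_of d m A b"
    using * by (auto simp: polyhedron_of_def space_R_def lookup_add lin_add lin_scaleR)
qed

text \<open>The slack \<open>\<beta> - lin d a x\<close> is affine and nonnegative on
  \<open>P\<close>. If it vanishes inside a segment of \<open>P\<close>, it vanishes at both
  ends.\<close>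

lemma lin_face_of:
  assumes "convex P" and le: "\<And>x. x \<in> P \<Longrightarrow> lin d a x \<le> \<beta>"
  shows "{x \<in> P. lin d a x = \<beta>} face_of P"
  unfolding face_of_def
proof (intro conjI ballI impI)
  show "convex {x \<in> P. lin d a x = \<beta>}"
  proof (rule convexI)
    fix x y and u v :: real
    assume *: "x \<in> {x \<in> P. lin d a x = \<beta>}" "y \<in> {x \<in> P. lin d a x = \<beta>}"
      "0 \<le> u" "0 \<le> v" "u + v = 1"
    then have "u * \<beta> + v * \<beta> = \<beta>" by (metis distrib_right mult_1)
    with * convexD[OF assms(1), of x y u v]
    show "u *\<^sub>R x + v *\<^sub>R y \<in> {x \<in> P. lin d a x = \<beta>}"
      by (auto simp: lin_add lin_scaleR)
  qed
next
  fix p q x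
  assume p: "p \<in> P" and q: "q \<in> P" and x: "x \<in> {x \<in> P. lin d a x = \<beta>}" "x \<in> open_segment p q"
  then obtain u where u: "0 < u" "u < 1" "x = (1 - u) *\<^sub>R p + u *\<^sub>R q"
    by (auto simp: in_segment)
  have "(1 - u) * lin d a p + u * lin d a q = \<beta>"
    using x(1) u(3) by (simp add: lin_add lin_scaleR)
  then have "(1 - u) * (\<beta> - lin d a p) + u * (\<beta> - lin d a q) = 0"
    by (simp add: algebra_simps)
  then have "\<beta> - lin d a p = 0 \<and> \<beta> - lin d a q = 0"
    using u le[OF p] le[OF q] by (intro convex_comb_extreme) auto
  with p q show "p \<in> {x \<in> P. lin d a x = \<beta>}" "q \<in> {x \<in> P. lin d a x = \<beta>}" by auto
qed auto

subsection \<open>Simplices whose slacks are the barycentric coordinates\<close>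

text \<open>Dimension, facets and vertex description all follow from these identities, so a concrete
  simplex needs only a finite computation. Row \<open>i\<close> belongs to the facet opposite
  \<open>v i\<close>.\<close>

locale slack_simplex =
  fixes d :: nat and A :: "nat \<Rightarrow> nat \<Rightarrow> real" and b :: "nat \<Rightarrow> real" and v :: "nat \<Rightarrow> rvec"
  assumes dim_pos: "0 < d"
    and vertex_space: "i < Suc d \<Longrightarrow> v i \<in> space_R d"
    and slack_vertex: "\<lbrakk>i < Suc d; j < Suc d\<rbrakk> \<Longrightarrow> b i - lin d (A i) (v j) = (if i = j then 1 else 0)"
    and slack_sum: "x \<in> space_R d \<Longrightarrow> (\<Sum>i<Suc d. b i - lin d (A i) x) = 1"
    and slack_decomp: "x \<in> space_R d \<Longrightarrow> (\<Sum>i<Suc d. (b i - lin d (A i) x) *\<^sub>R v i) = x"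
begin

lemma inj_vertices: "inj_on v {..<Suc d}"
proof (rule inj_onI)
  fix i j assume "i \<in> {..<Suc d}" "j \<in> {..<Suc d}" "v i = v j"
  then show "i = j" using slack_vertex[of i i] slack_vertex[of i j] by (auto split: if_splits)
qed

text \<open>Apply row \<open>i\<close> to a linear relation whose coefficients sum to 0: the
  constant \<open>b i\<close> drops out, and only the coefficient of \<open>v i\<close>
  survives.\<close>

lemma vertices_affine_independent: "\<not> affine_dependent (v ` {..<Suc d})"
proof
  assume "affine_dependent (v ` {..<Suc d})"
  then obtain U where U: "sum U (v ` {..<Suc d}) = 0" "\<exists>w\<in>v ` {..<Suc d}. U w \<noteq> 0"
    "(\<Sum>w\<in>v ` {..<Suc d}. U w *\<^sub>R w) = 0"
    by (auto simp: affine_dependent_explicit_finite)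
  have U1: "(\<Sum>j<Suc d. U (v j)) = 0"
    using U(1) unfolding sum.reindex[OF inj_vertices] o_def .
  have U3: "(\<Sum>j<Suc d. U (v j) *\<^sub>R v j) = 0"
    using U(3) unfolding sum.reindex[OF inj_vertices] o_def .
  have "U (v i) = 0" if i: "i < Suc d" for i
  proof -
    have "lin d (A i) (\<Sum>j<Suc d. U (v j) *\<^sub>R v j) = 0"
      unfolding U3 by (simp add: lin_def)
    then have "(\<Sum>j<Suc d. U (v j) * lin d (A i) (v j)) = 0"
      by (simp only: lin_sum lin_scaleR finite_lessThan)
    moreover have "U (v j) * lin d (A i) (v j) = U (v j) * b i - (if i = j then U (v j) else 0)"
      if "j < Suc d" for j
    proof -
      have "lin d (A i) (v j) = b i - (if i = j then 1 else 0)"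
        using slack_vertex[OF i that] by linarith
      then show ?thesis by (simp only:) (simp add: right_diff_distrib)
    qed
    ultimately have "(\<Sum>j<Suc d. U (v j) * b i - (if i = j then U (v j) else 0)) = 0"
      by (metis (no_types, lifting) lessThan_iff sum.cong)
    then have "(\<Sum>j<Suc d. U (v j)) * b i - U (v i) = 0"
      using i by (simp only: sum_subtractf sum_distrib_right sum.delta' finite_lessThan
          lessThan_iff if_True)
    then show ?thesis unfolding U1 by simp
  qed
  with U(2) show False by auto
qed

lemma affdim_hull_vertices:
  assumes "I \<subseteq> {..<Suc d}"
  shows "affdim (convex hull (v ` I)) = int (card I) - 1"
proof -
  have "card (v ` I) = card I"
    using inj_on_subset[OF inj_vertices assms] by (rule card_image)
  moreover have "\<not> affine_dependent (v ` I)"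
    using vertices_affine_independent affine_dependent_subset[of "v ` I"] assms by blast
  moreover have "finite (v ` I)" using assms finite_subset by blast
  ultimately show ?thesis
    using affdim_eqI[of "v ` I" "convex hull (v ` I)"] by (simp add: affine_hull_convex_hull)
qed

lemma vertex_in_polyhedron: "j < Suc d \<Longrightarrow> v j \<in> polyhedron_of d (Suc d) A b"
  unfolding polyhedron_of_def using vertex_space slack_vertex[of _ j]
  by (fastforce split: if_splits)

text \<open>The slacks of \<open>x\<close> serve as convex weights, and vertices of weight 0 are
  dropped. Taking all indices for \<open>I\<close> describes the whole polyhedron; leaving out one
  describes a facet.\<close>

lemma in_hull_of_zero_slack:
  assumes x: "x \<in> polyhedron_of d (Suc d) A b"
    and I: "I \<subseteq> {..<Suc d}" "\<And>i. i \<in> {..<Suc d} - I \<Longrightarrow> lin d (A i) x = b i"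
  shows "x \<in> convex hull (v ` I)"
proof -
  have xs: "x \<in> space_R d" and nonneg: "\<And>i. i < Suc d \<Longrightarrow> 0 \<le> b i - lin d (A i) x"
    using x by (auto simp: polyhedron_of_def)
  have "(\<Sum>i\<in>I. (b i - lin d (A i) x) *\<^sub>R v i) \<in> convex hull (v ` I)"
  proof (rule convex_sum)
    have "(\<Sum>i\<in>I. b i - lin d (A i) x) = (\<Sum>i<Suc d. b i - lin d (A i) x)"
      using I by (intro sum.mono_neutral_left) auto
    then show "(\<Sum>i\<in>I. b i - lin d (A i) x) = 1" using slack_sum[OF xs] by simp
    show "finite I" using I(1) finite_subset by blast
    show "0 \<le> b i - lin d (A i) x" "v i \<in> convex hull (v ` I)" if "i \<in> I" for i
      using that I(1) by (auto intro!: nonneg hull_inc simp del: diff_ge_0_iff_ge)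
  qed simp
  also have "(\<Sum>i\<in>I. (b i - lin d (A i) x) *\<^sub>R v i) = (\<Sum>i<Suc d. (b i - lin d (A i) x) *\<^sub>R v i)"
    using I by (intro sum.mono_neutral_left) auto
  finally show ?thesis unfolding slack_decomp[OF xs] .
qed

lemma polyhedron_eq_hull: "polyhedron_of d (Suc d) A b = convex hull (v ` {..<Suc d})"
proof
  show "convex hull (v ` {..<Suc d}) \<subseteq> polyhedron_of d (Suc d) A b"
    using vertex_in_polyhedron by (intro hull_minimal convex_polyhedron_of) auto
  show "polyhedron_of d (Suc d) A b \<subseteq> convex hull (v ` {..<Suc d})"
    using in_hull_of_zero_slack by auto
qed

text \<open>The face where row \<open>r\<close> is tight is the hull of the \<open>d\<close>
  vertices other than \<open>v r\<close>, which are affinely independent, so it has dimension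
  \<open>d - 1\<close>.\<close>

lemma facet_defining_row:
  assumes r: "r < Suc d"
  shows "facet_defining d (polyhedron_of d (Suc d) A b) (A r) (b r)"
proof -
  let ?P = "polyhedron_of d (Suc d) A b"
  let ?I = "{..<Suc d} - {r}"
  let ?T = "{x \<in> ?P. lin d (A r) x = b r}"
  have le: "lin d (A r) x \<le> b r" if "x \<in> ?P" for x
    using that r by (auto simp: polyhedron_of_def)
  have face: "?T face_of ?P"
    by (rule lin_face_of[OF convex_polyhedron_of le])
  have "?T = convex hull (v ` ?I)"
  proof
    show "?T \<subseteq> convex hull (v ` ?I)" using in_hull_of_zero_slack[of _ ?I] by auto
    have "v j \<in> ?T" if "j \<in> ?I" for j
      using that vertex_in_polyhedron slack_vertex[OF r, of j] by auto
    then show "convex hull (v ` ?I) \<subseteq> ?T"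
      using face by (intro hull_minimal face_of_imp_convex) auto
  qed
  moreover have "card ?I = d" using r by simp
  \<comment> \<open>A facet must be nonempty; this is where \<open>d\<close> being positive
    enters.\<close>
  moreover have "?I \<noteq> {}" using \<open>card ?I = d\<close> dim_pos by (metis card.empty less_irrefl)
  ultimately have "affdim ?T = int d - 1" "?T \<noteq> {}"
    using affdim_hull_vertices[of ?I] by auto
  moreover have "affdim ?P = int d"
    unfolding polyhedron_eq_hull using affdim_hull_vertices[of "{..<Suc d}"] by simp
  ultimately show ?thesis
    unfolding facet_defining_def is_facet_def using face le by auto
qed

end

subsection \<open>A four-dimensional simplex\<close>

text \<open>Coordinates 0, 1, 2 hold \<open>y\<close> and coordinate 3 holds \<open>w\<close>. Index
  0 is the origin, 1 the all-ones vector, and \<open>j + 2\<close> the vertex (e_j, 1).\<close>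

definition ex_vertex :: "nat \<Rightarrow> rvec" where
  "ex_vertex i = Poly_Mapping.single 3 (if i = 0 then 0 else 1) +
     (\<Sum>j<3. Poly_Mapping.single j (if i = 1 \<or> i = j + 2 then 1 else 0))"

text \<open>Numbered so that row \<open>i\<close> is opposite \<open>ex_vertex i\<close>. The factor
  1/2 makes the slack at that vertex exactly 1.\<close>

definition ex_row :: "nat \<Rightarrow> nat \<Rightarrow> real" where
  "ex_row i j =
     (if i = 0 then if j = 3 then 1 else 0
      else if i = 1 then if j = 3 then 1/2 else - 1/2
      else if j = 3 \<or> i = j + 2 then - 1/2 else 1/2)"

definition ex_rhs :: "nat \<Rightarrow> real" where
  "ex_rhs i = (if i = 0 then 1 else 0)"

lemma coord_ex_vertex:
  "coord (ex_vertex i) j =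
     (if j = 3 then if i = 0 then 0 else 1 else if j < 3 \<and> (i = 1 \<or> i = j + 2) then 1 else 0)"
  by (auto simp: ex_vertex_def lookup_add lookup_single when_def eval_nat_numeral lessThan_Suc)

lemma less_5_cases: "i < Suc 4 \<Longrightarrow> i = 0 \<or> i = 1 \<or> i = 2 \<or> i = 3 \<or> i = (4::nat)"
  by auto

lemma lin_ex_row:
  "lin 4 (ex_row 0) x = coord x 3"
  "lin 4 (ex_row (Suc 0)) x = (coord x 3 - coord x 0 - coord x 1 - coord x 2) / 2"
  "lin 4 (ex_row 2) x = (coord x 1 + coord x 2 - coord x 0 - coord x 3) / 2"
  "lin 4 (ex_row 3) x = (coord x 0 + coord x 2 - coord x 1 - coord x 3) / 2"
  "lin 4 (ex_row 4) x = (coord x 0 + coord x 1 - coord x 2 - coord x 3) / 2"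
  by (simp_all add: lin_def ex_row_def eval_nat_numeral field_simps)

lemma ex_vertex_zero_one: "ex_vertex i \<in> zero_one_vectors 4"
  by (auto simp: zero_one_vectors_def space_R_def coord_ex_vertex)

interpretation ex: slack_simplex 4 ex_row ex_rhs ex_vertex
proof
  show "ex_vertex i \<in> space_R 4" for i
    using ex_vertex_zero_one by (auto simp: zero_one_vectors_def)
  show "ex_rhs i - lin 4 (ex_row i) (ex_vertex j) = (if i = j then 1 else 0)"
    if "i < Suc 4" "j < Suc 4" for i j
    using less_5_cases[OF that(1)] less_5_cases[OF that(2)]
    by (elim disjE) (simp_all add: lin_ex_row ex_rhs_def coord_ex_vertex)
  have sum5: "(\<Sum>i<Suc 4. f i) = f 0 + f 1 + f 2 + f 3 + f 4" for f :: "nat \<Rightarrow> 'a::comm_monoid_add"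
    by (simp add: eval_nat_numeral)
  fix x assume x: "x \<in> space_R 4"
  show "(\<Sum>i<Suc 4. ex_rhs i - lin 4 (ex_row i) x) = 1"
    unfolding sum5 One_nat_def lin_ex_row by (simp add: ex_rhs_def field_simps)
  show "(\<Sum>i<Suc 4. (ex_rhs i - lin 4 (ex_row i) x) *\<^sub>R ex_vertex i) = x"
  proof (rule poly_mapping_eqI)
    fix k :: nat
    consider "k = 0" | "k = 1" | "k = 2" | "k = 3" | "k \<ge> 4" by linarith
    then show "coord (\<Sum>i<Suc 4. (ex_rhs i - lin 4 (ex_row i) x) *\<^sub>R ex_vertex i) k = coord x k"
      unfolding sum5 One_nat_def lin_ex_row lookup_add coord_scaleR
      using x by cases (simp_all add: ex_rhs_def coord_ex_vertex space_R_def field_simps)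
  qed
qed simp

section \<open>The two kinds of fixing on the face \<open>w = 0\<close>\<close>

definition ex_face :: "rvec set" where
  "ex_face = {x \<in> cube 4. coord x 3 = 0}"

lemma ex_face_face: "ex_face face_of cube 4"
  unfolding ex_face_def using coordinate_face[of 4 "{3}" "{}"] by simp

text \<open>The origin rules out coordinates fixed to 1, and the points \<open>p\<close> rule out
  fixing any of the first three to 0. At most the last coordinate is fixed, to 0.\<close>

lemma ex_face_subset_face:
  assumes G: "G face_of cube 4" and 0: "0 \<in> G"
    and 1: "\<And>i. i < 3 \<Longrightarrow> \<exists>p\<in>G. coord p i = 1"
  shows "ex_face \<subseteq> G"
proof -
  obtain I0 I1 where I: "I0 \<subseteq> {..<4}"
    "G = {x \<in> cube 4. (\<forall>i\<in>I0. coord x i = 0) \<and> (\<forall>i\<in>I1. coord x i = 1)}"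
    using G 0 unfolding face_of_cube_iff by auto
  have "I1 = {}" using 0 unfolding I(2) by auto
  moreover have "i = 3" if "i \<in> I0" for i
  proof (rule ccontr)
    assume "i \<noteq> 3"
    then have "i < 3" using that I(1) by fastforce
    with 1 obtain p where "p \<in> G" "coord p i = 1" by blast
    with that show False unfolding I(2) by auto
  qed
  ultimately show ?thesis unfolding I(2) ex_face_def by auto
qed

lemma ex_row_fixes_nothing:
  assumes r: "r < Suc 4"
  shows "sim_fix 4 (row_polytope 4 (ex_row r) (ex_rhs r)) ex_face = ex_face"
proof
  let ?R = "row_polytope 4 (ex_row r) (ex_rhs r)"
  \<comment> \<open>For \<open>r \<ge> 2\<close>, \<open>k\<close> is the one of the first three coordinates with a negative coefficient.\<close>
  define k where "k = (if r = 3 then 1 else if r = 4 then 2 else 0 :: nat)"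
  have in_fix: "p \<in> sim_fix 4 ?R ex_face"
    if "p \<in> zero_one_vectors 4" "coord p 3 = 0" "lin 4 (ex_row r) p \<le> ex_rhs r" for p
    using that zero_one_vectors_subset_cube[of 4] sim_fix_contains[of ?R ex_face 4]
    by (auto simp: row_polytope_def ex_face_def)
  show "sim_fix 4 ?R ex_face \<subseteq> ex_face" by (rule sim_fix_subset[OF ex_face_face])
  show "ex_face \<subseteq> sim_fix 4 ?R ex_face"
  proof (rule ex_face_subset_face[OF sim_fix_face])
    show "0 \<in> sim_fix 4 ?R ex_face"
      by (rule in_fix) (auto simp: zero_one_vectors_def space_R_def lin_def ex_rhs_def)
    fix i :: nat assume i: "i < 3"
    \<comment> \<open>The point is e_i + e_k, or e_k if \<open>i = k\<close>. For
      \<open>r \<ge> 2\<close> the entry -1/2 at \<open>k\<close> offsets the entry 1/2 at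
      \<open>i\<close>. For \<open>r < 2\<close> the choice \<open>k = 0\<close> is arbitrary, as
      these rows hold on all of \<open>ex_face\<close>.\<close>
    define p :: rvec where
      "p = Poly_Mapping.single i 1 + (if i = k then 0 else Poly_Mapping.single k 1)"
    have p: "coord p j = (if j = i \<or> j = k then 1 else 0)" for j
      by (auto simp: p_def lookup_add lookup_single when_def)
    have k: "k < 3" by (simp add: k_def)
    have "i = 0 \<or> i = 1 \<or> i = 2" using i by auto
    then have "lin 4 (ex_row r) p \<le> ex_rhs r"
      using less_5_cases[OF r]
      by (elim disjE) (simp_all only:, simp_all add: lin_ex_row p ex_rhs_def k_def)
    moreover have "p \<in> zero_one_vectors 4"
      using i k by (auto simp: zero_one_vectors_def space_R_def p)
    moreover have "coord p 3 = 0" using i k by (auto simp: p)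
    ultimately have "p \<in> sim_fix 4 ?R ex_face" by (intro in_fix)
    then show "\<exists>p\<in>sim_fix 4 ?R ex_face. coord p i = 1" by (intro bexI[of _ p]) (simp add: p)
  qed
qed

text \<open>No row shrinks \<open>ex_face\<close>, so the empty sequence of steps is already
  maximal, and the result is unique.\<close>

lemma seq_fix_ex: "seq_fix 4 (Suc 4) ex_row ex_rhs ex_face = ex_face"
  unfolding seq_fix_def
proof (rule the1_equality[OF seq_fix_ex1[OF ex_face_face]])
  show "(fix_step 4 (Suc 4) ex_row ex_rhs)\<^sup>*\<^sup>* ex_face ex_face \<and>
        (\<nexists>H. fix_step 4 (Suc 4) ex_row ex_rhs ex_face H)"
    using ex_row_fixes_nothing by (auto simp: fix_step_def simp del: less_Suc_eq)
qed

text \<open>It is enough to fix coordinate 0 to 0: the unit vector \<open>?e\<close> lies in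
  \<open>ex_face\<close> but violates this.\<close>

lemma sim_fix_ex: "sim_fix 4 (polyhedron_of 4 (Suc 4) ex_row ex_rhs) ex_face \<subset> ex_face"
proof -
  let ?P = "polyhedron_of 4 (Suc 4) ex_row ex_rhs"
  let ?G = "{x \<in> cube 4. coord x 0 = 0}"
  let ?e = "Poly_Mapping.single 0 1 :: rvec"
  have "coord x 0 = 0" if "x \<in> ?P" "x \<in> ex_face" for x
  proof -
    have row: "lin 4 (ex_row r) x \<le> ex_rhs r" if "r < Suc 4" for r
      using \<open>x \<in> ?P\<close> that by (auto simp: polyhedron_of_def)
    have "coord x 3 = 0" and "0 \<le> coord x 0"
      using that(2) cube_bounds by (auto simp: ex_face_def)
    \<comment> \<open>With \<open>w = 0\<close>, adding rows 3 and 4 cancels coordinates 1 and 2 and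
      leaves \<open>coord x 0 \<le> 0\<close>.\<close>
    then show ?thesis
      using row[of 3] row[of 4] unfolding lin_ex_row by (simp add: ex_rhs_def)
  qed
  then have "?P \<inter> ex_face \<inter> zero_one_vectors 4 \<subseteq> ?G"
    using zero_one_vectors_subset_cube by auto
  moreover have "?G face_of cube 4" using coordinate_face[of 4 "{0}" "{}"] by simp
  ultimately have "sim_fix 4 ?P ex_face \<subseteq> ?G" by (intro sim_fix_least)
  moreover have "?e \<in> ex_face"
    by (auto simp: ex_face_def cube_def space_R_def lookup_one when_def)
  moreover have "?e \<notin> ?G" by simp
  ultimately show ?thesis using sim_fix_subset[OF ex_face_face] by blast
qed

theorem theorem2:
  shows "\<exists>(d::nat) (P::rvec set) (m::nat) (A::nat \<Rightarrow> nat \<Rightarrow> real) (b::nat \<Rightarrow> real) (F::rvec set).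
    d > 0 \<and>
    P \<subseteq> cube d \<and> zero_one_polytope d P \<and> affdim P = int d \<and>
    (\<forall>r<m. facet_defining d P (A r) (b r)) \<and>
    P = polyhedron_of d m A b \<and>
    F face_of cube d \<and>
    sim_fix d P F \<subset> seq_fix d m A b F"
proof -
  let ?P = "polyhedron_of 4 (Suc 4) ex_row ex_rhs"
  have V: "ex_vertex ` {..<Suc 4} \<subseteq> zero_one_vectors 4" using ex_vertex_zero_one by blast
  then have "zero_one_polytope 4 ?P"
    unfolding zero_one_polytope_def using ex.polyhedron_eq_hull by blast
  \<comment> \<open>The rows do not list the bounds of the cube; containment comes from the
    vertices.\<close>
  moreover have "?P \<subseteq> cube 4"
    unfolding ex.polyhedron_eq_hull
    using V zero_one_vectors_subset_cube by (intro hull_minimal convex_cube) blast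
  moreover have "affdim ?P = int 4"
    unfolding ex.polyhedron_eq_hull using ex.affdim_hull_vertices[of "{..<Suc 4}"] by simp
  moreover have "sim_fix 4 ?P ex_face \<subset> seq_fix 4 (Suc 4) ex_row ex_rhs ex_face"
    unfolding seq_fix_ex by (rule sim_fix_ex)
  moreover have "\<forall>r<Suc 4. facet_defining 4 ?P (ex_row r) (ex_rhs r)"
    using ex.facet_defining_row by blast
  moreover have "(4::nat) > 0" by simp
  ultimately show ?thesis
    using ex_face_face
    by (intro exI[of _ 4] exI[of _ ?P] exI[of _ "Suc 4"] exI[of _ ex_row] exI[of _ ex_rhs]
        exI[of _ ex_face] conjI) (assumption | rule refl)+
qed

end
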